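(* Let $A,B,C$ be finite-dimensional complex vector spaces with $\dim A=m$, and let $T\in A\otimes B\otimes C$ be $A$-concise. If $\underline{\mathbf R}(T)=m$ and $\mathbb{P}T(A^* )\cap\mathrm{Seg}(\mathbb{P}B\times\mathbb{P}C)=[X_0]$ is a single point, then $\mathbb{P}\bigl(T(A^* )\cap\hat T_{[X_0]}\mathrm{Seg}(\mathbb{P}B\times\mathbb{P}C)\bigr)$ must contain a line.
   Context: $T$ is viewed as a linear map $T:A^*\to B\otimes C$ with image $T(A^* )$; $T$ is $A$-concise if this map is injective. The border rank $\underline{\mathbf R}(T)$ is the least $r$ such that $T$ is a limit of sums of $r$ tensors $a\otimes b\otimes c$. $\mathrm{Seg}(\mathbb{P}B\times\mathbb{P}C)\subset\mathbb{P}(B\otimes C)$ is the Segre variety of rank one elements, and $\hat T_{[X_0]}\mathrm{Seg}(\mathbb{P}B\times\mathbb{P}C)\subset B\otimes C$ is its affine tangent space at $[X_0]$.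
   Formalization: The formal statement assumes m ≥ 2; for m = 1 the claim is false, since for T = a⊗b⊗c the space T(A* ) is one-dimensional and its projectivization is a point, which contains no line. *)

theory Defs
  imports "HOL-Analysis.Analysis"
begin

(* With A = complex^'a, B = complex^'b, C = complex^'c, the tensor products
   B \<otimes> C and A \<otimes> B \<otimes> C are the coordinate spaces complex^('b \<times> 'c) and
   complex^('a \<times> 'b \<times> 'c), with the products of standard basis vectors as basis;
   complex linear algebra on them is the library's, over the scalar product *s. *)

definition tensor2 :: "complex^'b \<Rightarrow> complex^'c \<Rightarrow> complex^('b::finite \<times> 'c::finite)" where
  "tensor2 b c = vec_lambda (\<lambda>(j, k). b $ j * c $ k)"

definition tensor3 ::
  "complex^'a \<Rightarrow> complex^'b \<Rightarrow> complex^'c \<Rightarrow> complex^('a::finite \<times> 'b::finite \<times> 'c::finite)" where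
  "tensor3 a b c = vec_lambda (\<lambda>(i, j, k). a $ i * b $ j * c $ k)"

definition dual_space :: "(complex^'a::finite \<Rightarrow> complex) set" where
  "dual_space = {\<alpha>. Vector_Spaces.linear (*s) (*) \<alpha>}"

(* The map A* \<rightarrow> B \<otimes> C determined by a \<otimes> b \<otimes> c \<mapsto> (\<alpha> \<mapsto> \<alpha>(a) b \<otimes> c). *)
definition tensor_map ::
  "complex^('a::finite \<times> 'b::finite \<times> 'c::finite) \<Rightarrow> (complex^'a \<Rightarrow> complex) \<Rightarrow> complex^('b \<times> 'c)" where
  "tensor_map T \<alpha> = vec_lambda (\<lambda>(j, k). \<Sum>i\<in>UNIV. \<alpha> (axis i 1) * T $ (i, j, k))"

definition A_concise :: "complex^('a::finite \<times> 'b::finite \<times> 'c::finite) \<Rightarrow> bool" where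
  "A_concise T \<longleftrightarrow> inj_on (tensor_map T) dual_space"

definition sums_of_rank_one :: "nat \<Rightarrow> (complex^('a::finite \<times> 'b::finite \<times> 'c::finite)) set" where
  "sums_of_rank_one r = {\<Sum>i<r. tensor3 (a i) (b i) (c i) | a b c. True}"

definition border_rank :: "complex^('a::finite \<times> 'b::finite \<times> 'c::finite) \<Rightarrow> nat" where
  "border_rank T = (LEAST r. \<exists>S. (\<forall>n. S n \<in> sums_of_rank_one r) \<and> S \<longlonglongrightarrow> T)"

(* A point of projective space is represented by the one-dimensional linear subspace
   it stands for. *)
definition proj_point :: "complex^'n::finite \<Rightarrow> (complex^'n) set" where
  "proj_point x = vec.span {x}"

definition projectivization :: "(complex^'n::finite) set \<Rightarrow> (complex^'n) set set" where
  "projectivization V = proj_point ` (V - {0})"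

definition projective_line :: "(complex^'n::finite) set set \<Rightarrow> bool" where
  "projective_line l \<longleftrightarrow> (\<exists>L. vec.subspace L \<and> vec.dim L = 2 \<and> l = projectivization L)"

definition segre :: "(complex^('b::finite \<times> 'c::finite)) set set" where
  "segre = {proj_point (tensor2 b c) | b c. b \<noteq> 0 \<and> c \<noteq> 0}"

definition affine_cone :: "(complex^'n::finite) set set \<Rightarrow> (complex^'n) set" where
  "affine_cone X = insert 0 (\<Union>X)"

(* The tangent space to the affine cone over X along the line p: the span of the velocities
   of holomorphic curves in the cone passing at time 0 through a nonzero vector of p.
   For X smooth at p the set of velocities is already a linear subspace. *)
definition affine_tangent_space ::
  "(complex^'n::finite) set set \<Rightarrow> (complex^'n) set \<Rightarrow> (complex^'n) set" where
  "affine_tangent_space X p = vec.span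
     {(\<chi> i. deriv (\<lambda>t. \<gamma> t $ i) 0) | \<gamma>. \<exists>U. open U \<and> 0 \<in> U \<and>
        (\<forall>i. (\<lambda>t. \<gamma> t $ i) holomorphic_on U) \<and>
        (\<forall>t\<in>U. \<gamma> t \<in> affine_cone X) \<and> \<gamma> 0 \<in> p \<and> \<gamma> 0 \<noteq> 0}"

end

theory Submission imports Defs begin

text \<open>
  Write T as the limit of tensors S n of rank at most m. For large n the map of S n is injective,
  so its image is spanned by m independent matrices of rank one. Choose two of them for each n.
  Their limits, up to scale and subsequence, have rank one and lie in the image of T, so both are
  the point of the hypothesis. The secant lines through the two chosen points then converge to a
  line inside the image of T, and it is tangent to the Segre variety at that point.
\<close>

section \<open>The map of a tensor in coordinates on the dual space\<close>

text \<open>The functional is replaced by its vector of values on the standard basis, so that the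
  domain becomes a normed space in which compactness and dimension arguments apply. The remaining
  two tensor factors are merged into one index type \<open>'d\<close>.\<close>

definition contract :: "complex^('a::finite \<times> 'd::finite) \<Rightarrow> complex^'a \<Rightarrow> complex^'d" where
  "contract T \<alpha> = (\<chi> p. \<Sum>i\<in>UNIV. \<alpha> $ i * T $ (i, p))"

lemma contract_nth [simp]: "contract T \<alpha> $ p = (\<Sum>i\<in>UNIV. \<alpha> $ i * T $ (i, p))"
  by (simp add: contract_def)

lemma tensor_map_eq_contract: "tensor_map T f = contract T (\<chi> i. f (axis i 1))"
  by (auto simp: tensor_map_def vec_eq_iff)

text \<open>Each vector \<alpha> comes from the functional that sends x to the sum of \<alpha>_i
  x_i. Hence passing from functionals to vectors leaves the image of the tensor map
  unchanged.\<close>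

lemma dual_space_coordinates: "(\<lambda>f. \<chi> i. f (axis i 1)) ` dual_space = (UNIV :: (complex^'a::finite) set)"
proof -
  have "\<alpha> \<in> (\<lambda>f. \<chi> i. f (axis i 1)) ` dual_space" for \<alpha> :: "complex^'a"
  proof (rule image_eqI)
    let ?f = "\<lambda>x :: complex^'a. \<Sum>i\<in>UNIV. \<alpha> $ i * x $ i"
    show "\<alpha> = (\<chi> i. ?f (axis i 1))"
      by (simp add: vec_eq_iff axis_def if_distrib cong: if_cong)
    show "?f \<in> dual_space"
      unfolding dual_space_def
      by (simp, unfold_locales) (simp_all add: algebra_simps sum.distrib sum_distrib_left)
  qed
  then show ?thesis by blast
qed

lemma image_tensor_map: "tensor_map T ` dual_space = range (contract T)"
  unfolding dual_space_coordinates[symmetric] by (simp add: image_image tensor_map_eq_contract)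

lemma A_concise_imp_inj_contract:
  assumes "A_concise T" shows "inj (contract T)"
proof (rule injI)
  fix \<alpha> \<beta> assume eq: "contract T \<alpha> = contract T \<beta>"
  have "\<alpha> \<in> (\<lambda>f. \<chi> i. f (axis i 1)) ` dual_space" "\<beta> \<in> (\<lambda>f. \<chi> i. f (axis i 1)) ` dual_space"
    by (simp_all add: dual_space_coordinates)
  then obtain f g where "f \<in> dual_space" "\<alpha> = (\<chi> i. f (axis i 1))" "g \<in> dual_space" "\<beta> = (\<chi> i. g (axis i 1))"
    by blast
  then show "\<alpha> = \<beta>"
    using eq assms unfolding A_concise_def inj_on_def by (metis tensor_map_eq_contract)
qed

lemma vec_linear_contract: "Vector_Spaces.linear (*s) (*s) (contract T)"
  by unfold_locales (simp_all add: vec_eq_iff algebra_simps sum.distrib sum_distrib_left)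

lemma contract_tensor3:
  "contract (tensor3 a b c) \<alpha> = (\<Sum>i\<in>UNIV. \<alpha> $ i * a $ i) *s tensor2 b c"
  by (auto simp: vec_eq_iff tensor3_def tensor2_def sum_distrib_right mult.assoc)

lemma bounded_bilinear_contract: "bounded_bilinear contract"
  unfolding bilinear_conv_bounded_bilinear[symmetric] bilinear_def
  by (intro conjI allI linearI)
    (simp_all add: vec_eq_iff algebra_simps sum.distrib scaleR_sum_right)

section \<open>Stability of injectivity and limits of images\<close>

text \<open>An injective linear map in finite dimension stretches norms by at least some positive
  factor, and a small perturbation costs at most half of that factor. A constant valid for all large
  n keeps preimages under the varying maps bounded.\<close>

lemma contract_uniformly_bounded_below:
  fixes T :: "complex^('a::finite \<times> 'd::finite)"
  assumes "inj (contract T)" "S \<longlonglongrightarrow> T"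
  obtains c where "c > 0" "\<forall>\<^sub>F n in sequentially. \<forall>\<alpha>. c * norm \<alpha> \<le> norm (contract (S n) \<alpha>)"
proof -
  interpret bounded_bilinear "contract :: complex^('a \<times> 'd) \<Rightarrow> complex^'a \<Rightarrow> complex^'d"
    by (rule bounded_bilinear_contract)
  obtain c where c: "c > 0" "\<And>\<alpha>. c * norm \<alpha> \<le> norm (contract T \<alpha>)"
    using linear_inj_bounded_below_pos[OF bounded_linear.linear[OF bounded_linear_right] assms(1)]
    by metis
  obtain K where K: "K > 0" "\<And>(U :: complex^('a \<times> 'd)) \<alpha>. norm (contract U \<alpha>) \<le> norm U * norm \<alpha> * K"
    using pos_bounded by metis
  \<comment> \<open>The radius is chosen so that, with \<open>K\<close> bounding the bilinear map,
    the difference of the two maps has operator norm at most c/2.\<close>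
  have "\<forall>\<^sub>F n in sequentially. dist (S n) T < c / (2 * K)"
    using assms(2) c(1) K(1) by (intro tendstoD) auto
  then have "\<forall>\<^sub>F n in sequentially. \<forall>\<alpha>. c / 2 * norm \<alpha> \<le> norm (contract (S n) \<alpha>)"
  proof eventually_elim
    case (elim n)
    show ?case
    proof
      fix \<alpha>
      have "norm (contract T \<alpha>) - norm (contract (S n) \<alpha>) \<le> norm (contract (S n - T) \<alpha>)"
        by (metis diff_left norm_minus_commute norm_triangle_ineq2)
      also have "\<dots> \<le> norm (S n - T) * norm \<alpha> * K" by (rule K(2))
      also have "\<dots> \<le> c / (2 * K) * norm \<alpha> * K"
        using elim K(1) by (intro mult_right_mono) (auto simp: dist_norm)
      also have "\<dots> = c / 2 * norm \<alpha>" using K(1) by simp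
      finally show "c / 2 * norm \<alpha> \<le> norm (contract (S n) \<alpha>)"
        using c(2)[of \<alpha>] by simp
    qed
  qed
  then show thesis using that[of "c / 2"] c(1) by simp
qed

text \<open>Preimages of the \<open>x n\<close> stay bounded by the uniform lower bound, so a
  subsequence of them converges. Joint continuity of \<open>contract\<close> then makes the limit a
  preimage of \<open>X\<close>.\<close>

lemma limit_in_range_contract:
  assumes "inj (contract T)" "S \<longlonglongrightarrow> T"
    and x: "\<And>n. x n \<in> range (contract (S n))" "x \<longlonglongrightarrow> X"
  shows "X \<in> range (contract T)"
proof -
  have "\<forall>n. \<exists>\<alpha>. x n = contract (S n) \<alpha>" using x(1) by blast
  then obtain \<alpha> where \<alpha>: "\<And>n. x n = contract (S n) (\<alpha> n)" by metis
  obtain c where c: "c > 0" "\<forall>\<^sub>F n in sequentially. \<forall>\<alpha>. c * norm \<alpha> \<le> norm (contract (S n) \<alpha>)"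
    using contract_uniformly_bounded_below assms by blast
  have "Bseq x" using x(2) convergentI convergent_imp_Bseq by blast
  then obtain K where K: "\<And>n. norm (x n) \<le> K" unfolding Bseq_def by blast
  from c(2) have "\<forall>\<^sub>F n in sequentially. norm (\<alpha> n) \<le> norm (K / c)"
  proof eventually_elim
    case (elim n)
    then have "c * norm (\<alpha> n) \<le> K" using \<alpha> K order_trans by metis
    then show ?case using c(1) by (simp add: field_simps)
  qed
  then have "Bseq \<alpha>" using Bseq_eventually_mono[of \<alpha> "\<lambda>n. K / c"] by simp
  then have "bounded (range \<alpha>)" by (simp add: Bseq_eq_bounded)
  then obtain \<beta> r where r: "strict_mono r" "(\<alpha> \<circ> r) \<longlonglongrightarrow> \<beta>"
    using bounded_imp_convergent_subsequence by blast
  have "(\<lambda>n. contract ((S \<circ> r) n) ((\<alpha> \<circ> r) n)) \<longlonglongrightarrow> contract T \<beta>"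
    using bounded_bilinear.tendsto[OF bounded_bilinear_contract LIMSEQ_subseq_LIMSEQ[OF assms(2) r(1)] r(2)] .
  moreover have "(x \<circ> r) \<longlonglongrightarrow> X" using x(2) r(1) by (rule LIMSEQ_subseq_LIMSEQ)
  ultimately show ?thesis using \<alpha> by (auto simp: o_def dest: LIMSEQ_unique)
qed

lemma range_contract_scaleR:
  "x \<in> range (contract T) \<Longrightarrow> a *\<^sub>R x \<in> range (contract T)"
  by (auto simp: bounded_bilinear.scaleR_right[OF bounded_bilinear_contract, symmetric])

lemma vec_subspace_range_contract: "vec.subspace (range (contract T))"
proof -
  interpret Vector_Spaces.linear "(*s)" "(*s)" "contract T" by (rule vec_linear_contract)
  show ?thesis by (rule subspace_image[OF vec.subspace_UNIV])
qed

text \<open>Normalizing puts the vectors on the unit sphere, which is compact. The limit has norm 1,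
  so it cannot degenerate to zero.\<close>

lemma sgn_limit_in_range_contract:
  assumes "inj (contract T)" "S \<longlonglongrightarrow> T"
    and x: "\<And>n. x n \<in> range (contract (S n))" "\<And>n. x n \<noteq> 0"
  obtains r X where "strict_mono r" "(\<lambda>n. sgn (x (r n))) \<longlonglongrightarrow> X" "X \<in> range (contract T)" "X \<noteq> 0"
proof -
  have "bounded (range (\<lambda>n. sgn (x n)))"
    by (rule boundedI[where B = 1]) (auto simp: norm_sgn)
  then obtain X r where r: "strict_mono r" "((\<lambda>n. sgn (x n)) \<circ> r) \<longlonglongrightarrow> X"
    using bounded_imp_convergent_subsequence by blast
  have "X \<in> range (contract T)"
    using assms(1) LIMSEQ_subseq_LIMSEQ[OF assms(2) r(1)]
  proof (rule limit_in_range_contract[OF _ _ _ r(2)])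
    show "((\<lambda>n. sgn (x n)) \<circ> r) n \<in> range (contract ((S \<circ> r) n))" for n
      using x(1) by (simp add: sgn_div_norm range_contract_scaleR)
  qed
  moreover have "norm X = 1"
    using tendsto_norm[OF r(2)] x(2) by (simp add: o_def norm_sgn LIMSEQ_const_iff)
  ultimately show thesis using that[of r X] r norm_zero by (fastforce simp: o_def)
qed

section \<open>Rank one matrices through their minors\<close>

text \<open>These are the 2 by 2 minors, so the condition says rank at most one. As a system of
  polynomial equations it passes to limits without any control of the factors of a rank one
  matrix.\<close>

definition minors_vanish :: "complex^('b::finite \<times> 'c::finite) \<Rightarrow> bool" where
  "minors_vanish M \<longleftrightarrow> (\<forall>i j k l. M $ (i, l) * M $ (j, k) = M $ (i, k) * M $ (j, l))"

lemma minors_vanish_tensor2: "minors_vanish (tensor2 b c)"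
  by (simp add: minors_vanish_def tensor2_def)

lemma minors_vanish_scale: "minors_vanish M \<Longrightarrow> minors_vanish (a *s M)"
  by (simp add: minors_vanish_def mult_ac)

lemma minors_vanish_scaleR: "minors_vanish M \<Longrightarrow> minors_vanish (a *\<^sub>R M)"
  by (simp add: minors_vanish_def)

lemma minors_vanish_limit:
  assumes "\<And>n. minors_vanish (x n)" "x \<longlonglongrightarrow> X"
  shows "minors_vanish X"
  unfolding minors_vanish_def
proof (intro allI)
  fix i j k l
  have eq: "x n $ (i, l) * x n $ (j, k) = x n $ (i, k) * x n $ (j, l)" for n
    using assms(1) unfolding minors_vanish_def by blast
  have "(\<lambda>n. x n $ (i, l) * x n $ (j, k)) \<longlonglongrightarrow> X $ (i, l) * X $ (j, k)"
    using assms(2) by (intro tendsto_mult tendsto_vec_nth)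
  moreover have "(\<lambda>n. x n $ (i, l) * x n $ (j, k)) \<longlonglongrightarrow> X $ (i, k) * X $ (j, l)"
    unfolding eq using assms(2) by (intro tendsto_mult tendsto_vec_nth)
  ultimately show "X $ (i, l) * X $ (j, k) = X $ (i, k) * X $ (j, l)"
    by (rule LIMSEQ_unique)
qed

text \<open>At a nonzero pivot entry, the minors express the matrix as the product of the pivot
  column, divided by the pivot, and the pivot row.\<close>

lemma minors_vanish_imp_proj_point_in_segre:
  assumes "minors_vanish M" "M \<noteq> 0"
  shows "proj_point M \<in> segre"
proof -
  obtain j k where jk: "M $ (j, k) \<noteq> 0" using assms(2) by (auto simp: vec_eq_iff)
  let ?b = "\<chi> i. M $ (i, k) / M $ (j, k)" and ?c = "\<chi> l. M $ (j, l)"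
  have "M = tensor2 ?b ?c"
    using assms(1) jk by (auto simp: vec_eq_iff tensor2_def minors_vanish_def field_simps)
  moreover have "?b \<noteq> 0" "?c \<noteq> 0" using jk by (auto simp: vec_eq_iff)
  ultimately have "proj_point M = proj_point (tensor2 ?b ?c) \<and> ?b \<noteq> 0 \<and> ?c \<noteq> 0" by simp
  then show ?thesis unfolding segre_def by blast
qed

lemma proj_point_eqD:
  assumes "proj_point x = proj_point y" "x \<noteq> 0"
  obtains a where "a \<noteq> 0" "y = a *s x"
proof -
  have "y \<in> vec.span {x}" using assms(1) vec.span_base[of y "{y}"] by (simp add: proj_point_def)
  then obtain a where a: "y = a *s x" by (auto simp: vec.span_singleton)
  have "x \<in> vec.span {y}" using assms(1) vec.span_base[of x "{x}"] by (simp add: proj_point_def)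
  then have "y \<noteq> 0" using assms(2) by (auto simp: vec.span_singleton)
  with a that show thesis by auto
qed

section \<open>Border rank and spanning sets of rank one matrices\<close>

lemma tensor_eq_sum_tensor3:
  "T = (\<Sum>(i, j, k)\<in>UNIV. tensor3 (axis i (T $ (i, j, k))) (axis j 1) (axis k 1))"
proof -
  have "(\<Sum>(i, j, k)\<in>UNIV. tensor3 (axis i (T $ (i, j, k))) (axis j 1) (axis k 1)) $ p = T $ p" for p
  proof -
    obtain i j k where p: "p = (i, j, k)" by (cases p)
    have "(\<Sum>(i, j, k)\<in>UNIV. tensor3 (axis i (T $ (i, j, k))) (axis j 1) (axis k 1)) $ p
      = (\<Sum>q\<in>UNIV. if q = p then T $ p else 0)"
      unfolding sum_component
      by (rule sum.cong) (auto simp: p tensor3_def axis_def split: if_splits)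
    then show ?thesis by simp
  qed
  then show ?thesis by (simp add: vec_eq_iff)
qed

text \<open>The expansion in basis tensors, one summand per entry, shows that some length is always
  attained. This makes the \<open>LEAST\<close> in \<open>border_rank\<close> a genuine
  minimum.\<close>

lemma sums_of_rank_one_exhaustive:
  "T \<in> sums_of_rank_one CARD('a \<times> 'b \<times> 'c)"
  for T :: "complex^('a::finite \<times> 'b::finite \<times> 'c::finite)"
proof -
  obtain h where h: "bij_betw h {..<CARD('a \<times> 'b \<times> 'c)} (UNIV :: ('a \<times> 'b \<times> 'c) set)"
    using bij_betw_from_nat_into_finite[of "UNIV :: ('a \<times> 'b \<times> 'c) set"] by auto
  let ?a = "\<lambda>n. axis (fst (h n)) (T $ h n)" and ?b = "\<lambda>n. axis (fst (snd (h n))) 1"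
    and ?c = "\<lambda>n. axis (snd (snd (h n))) 1"
  have "T = (\<Sum>n<CARD('a \<times> 'b \<times> 'c). tensor3 (?a n) (?b n) (?c n))"
    by (subst tensor_eq_sum_tensor3, subst sum.reindex_bij_betw[OF h, symmetric])
      (simp add: case_prod_unfold)
  then show ?thesis
    unfolding sums_of_rank_one_def by (intro CollectI exI[of _ ?a] exI[of _ ?b] exI[of _ ?c]) simp
qed

lemma border_rank_approximation:
  obtains S where "\<And>n. S n \<in> sums_of_rank_one (border_rank T)" "S \<longlonglongrightarrow> T"
proof -
  let ?P = "\<lambda>r. \<exists>S. (\<forall>n. S n \<in> sums_of_rank_one r) \<and> S \<longlonglongrightarrow> T"
  have "\<exists>r. ?P r"
    using sums_of_rank_one_exhaustive[of T] by (intro exI[of _ "\<lambda>_. T"] exI) (auto intro: tendsto_const)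
  then have "?P (LEAST r. ?P r)" by (rule LeastI_ex)
  then show thesis using that unfolding border_rank_def by blast
qed

text \<open>The image has dimension \<open>CARD('a)\<close> by injectivity and lies in the span of
  the \<open>CARD('a)\<close> rank one matrices from the decomposition. Counting dimensions forces
  these matrices to be distinct and independent, and their span to equal the image; in particular
  they lie in the image.\<close>

lemma rank_one_basis_of_range_contract:
  fixes S :: "complex^('a::finite \<times> 'b::finite \<times> 'c::finite)"
  assumes "S \<in> sums_of_rank_one CARD('a)" "inj (contract S)"
  obtains b c where "inj_on (\<lambda>i. tensor2 (b i) (c i)) {..<CARD('a)}"
    "vec.independent ((\<lambda>i. tensor2 (b i) (c i)) ` {..<CARD('a)})"
    "(\<lambda>i. tensor2 (b i) (c i)) ` {..<CARD('a)} \<subseteq> range (contract S)"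
proof -
  obtain a b c where S: "S = (\<Sum>i<CARD('a). tensor3 (a i) (b i) (c i))"
    using assms(1) unfolding sums_of_rank_one_def by auto
  interpret bounded_bilinear "contract :: complex^('a \<times> 'b \<times> 'c) \<Rightarrow> complex^'a \<Rightarrow> complex^('b \<times> 'c)"
    by (rule bounded_bilinear_contract)
  define W where "W = (\<lambda>i. tensor2 (b i) (c i)) ` {..<CARD('a)}"
  have "contract S \<alpha> \<in> vec.span W" for \<alpha>
    unfolding S sum_left contract_tensor3 W_def
    by (intro vec.span_sum vec.span_scale vec.span_base) auto
  then have sub: "range (contract S) \<subseteq> vec.span W" by auto
  have dimR: "vec.dim (range (contract S)) = CARD('a)"
    using vec.dim_image_eq[OF vec_linear_contract, of S UNIV] assms(2)
    by (simp add: vec.span_UNIV vec.dim_UNIV card_cart_basis)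
  have fin: "finite W" by (simp add: W_def)
  have le: "card W \<le> CARD('a)" using card_image_le[of "{..<CARD('a)}"] by (simp add: W_def)
  have dimW: "vec.dim W = CARD('a)"
    using vec.dim_subset[OF sub] vec.dim_le_card'[OF fin] le dimR by simp
  then have card: "card W = CARD('a)" using vec.dim_le_card'[OF fin] le by simp
  have "range (contract S) = vec.span W"
    using vec.subspace_dim_equal[OF vec_subspace_range_contract vec.subspace_span sub] dimR dimW by simp
  moreover have "vec.independent W"
    using vec.card_le_dim_spanning[of W "vec.span W"] vec.span_superset[of W] fin dimW card by simp
  moreover have "inj_on (\<lambda>i. tensor2 (b i) (c i)) {..<CARD('a)}"
    using card by (intro eq_card_imp_inj_on) (auto simp: W_def)
  ultimately show thesis using that[of b c, folded W_def] vec.span_superset[of W] by simp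
qed

lemma two_independent_rank_ones:
  fixes S :: "complex^('a::finite \<times> 'b::finite \<times> 'c::finite)"
  assumes "S \<in> sums_of_rank_one CARD('a)" "inj (contract S)" "CARD('a) \<ge> 2"
  obtains x y where "minors_vanish x" "minors_vanish y" "x \<noteq> y" "vec.independent {x, y}"
    "x \<in> range (contract S)" "y \<in> range (contract S)"
proof -
  obtain b c where bc: "inj_on (\<lambda>i. tensor2 (b i) (c i)) {..<CARD('a)}"
    "vec.independent ((\<lambda>i. tensor2 (b i) (c i)) ` {..<CARD('a)})"
    "(\<lambda>i. tensor2 (b i) (c i)) ` {..<CARD('a)} \<subseteq> range (contract S)"
    using rank_one_basis_of_range_contract[OF assms(1,2)] by blast
  let ?w = "\<lambda>i. tensor2 (b i) (c i)"
  have "?w 0 \<noteq> ?w 1" using inj_onD[OF bc(1), of 0 1] assms(3) by auto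
  moreover have sub: "{?w 0, ?w 1} \<subseteq> ?w ` {..<CARD('a)}" using assms(3) by auto
  moreover have "vec.independent {?w 0, ?w 1}" using vec.independent_mono[OF bc(2) sub] .
  ultimately show thesis using that[of "?w 0" "?w 1"] bc(3) minors_vanish_tensor2 by blast
qed

section \<open>Tangent vectors of the Segre variety\<close>

text \<open>By the product rule, this is the velocity at 0 of the curve obtained by moving b in
  direction u and c in direction v.\<close>

lemma velocity_in_affine_tangent_space:
  fixes b u :: "complex^'b::finite" and c v :: "complex^'c::finite"
  assumes "tensor2 b c \<in> p" "tensor2 b c \<noteq> 0"
  shows "tensor2 u c + tensor2 b v \<in> affine_tangent_space segre p"
proof -
  let ?\<gamma> = "\<lambda>t. tensor2 (b + t *s u) (c + t *s v)"
  have "((\<lambda>t. ?\<gamma> t $ i) has_field_derivative (tensor2 u c + tensor2 b v) $ i) (at 0)" for i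
    by (cases i) (auto simp: tensor2_def intro!: derivative_eq_intros)
  then have "deriv (\<lambda>t. ?\<gamma> t $ i) 0 = (tensor2 u c + tensor2 b v) $ i" for i
    by (rule DERIV_imp_deriv)
  then have "tensor2 u c + tensor2 b v = (\<chi> i. deriv (\<lambda>t. ?\<gamma> t $ i) 0)"
    by (simp only: vec_lambda_eta)
  moreover have "(\<lambda>t. ?\<gamma> t $ i) holomorphic_on UNIV" for i
    by (cases i) (auto simp: tensor2_def intro!: holomorphic_intros)
  \<comment> \<open>A factor of the curve may vanish at some t. The cone contains 0, so the curve
    stays inside it on the whole plane and \<open>UNIV\<close> can serve as the domain.\<close>
  moreover have "tensor2 x y \<in> affine_cone segre" for x :: "complex^'b" and y :: "complex^'c"
  proof (cases "x = 0 \<or> y = 0")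
    case True
    then have "tensor2 x y = 0" by (auto simp: tensor2_def vec_eq_iff)
    then show ?thesis by (simp add: affine_cone_def)
  next
    case False
    then have "proj_point (tensor2 x y) \<in> segre" by (auto simp: segre_def)
    moreover have "tensor2 x y \<in> proj_point (tensor2 x y)"
      by (simp add: proj_point_def vec.span_base)
    ultimately show ?thesis by (auto simp: affine_cone_def)
  qed
  moreover have "?\<gamma> 0 = tensor2 b c" by simp
  ultimately show ?thesis
    unfolding affine_tangent_space_def using assms
    by (intro vec.span_base CollectI exI[of _ ?\<gamma>] conjI exI[of _ UNIV]) simp_all
qed

section \<open>Limits of secant directions\<close>

lemma independent_pairD:
  assumes "vec.independent {x, y}" "x \<noteq> y" "a *s x = b *s y"
  shows "a = 0"
proof (rule ccontr)
  assume "a \<noteq> 0"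
  then have "x = (b / a) *s y"
    using arg_cong[OF assms(3), of "\<lambda>v. inverse a *s v"] by (simp add: divide_inverse mult.commute)
  then have "x \<in> vec.span {y}" by (metis vec.span_base vec.span_scale singletonI)
  then show False using assms(1,2) by (simp add: vec.independent_insert)
qed

text \<open>
  Two distinct matrices of rank one, both scaled to have the entry 1 at the position (j, k),
  have a difference that is zero there, so that the limit of the secant directions cannot fall
  back onto the common limit point.
\<close>

lemma secant_limit:
  assumes "\<And>n. minors_vanish (x n)" "\<And>n. minors_vanish (y n)"
    and "\<And>n. x n $ (j, k) = 1" "\<And>n. y n $ (j, k) = 1"
    and "x \<longlonglongrightarrow> X" "y \<longlonglongrightarrow> X" "(\<lambda>n. sgn (x n - y n)) \<longlonglongrightarrow> Z"
  shows "Z = tensor2 (\<chi> i. Z $ (i, k)) (\<chi> l. X $ (j, l)) + tensor2 (\<chi> i. X $ (i, k)) (\<chi> l. Z $ (j, l))"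
    and "Z $ (j, k) = 0"
proof -
  let ?z = "\<lambda>n. sgn (x n - y n)"
  have z: "(\<lambda>n. ?z n $ p) \<longlonglongrightarrow> Z $ p" for p using assms(7) by (intro tendsto_intros)
  have Z: "Z $ (i, l) = Z $ (i, k) * X $ (j, l) + X $ (i, k) * Z $ (j, l)" for i l
  proof (rule LIMSEQ_unique[OF z])
    \<comment> \<open>This is a product rule for differences: with entry 1 at the pivot, each matrix
      is the product of its pivot column and pivot row, and the mixed term cancels. The identity is
      linear in the difference, so it survives the rescaling by \<open>sgn\<close>.\<close>
    have "(x n - y n) $ (i, l)
      = (x n - y n) $ (i, k) * x n $ (j, l) + y n $ (i, k) * (x n - y n) $ (j, l)" for n
    proof -
      have "x n $ (i, l) = x n $ (i, k) * x n $ (j, l)" "y n $ (i, l) = y n $ (i, k) * y n $ (j, l)"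
        using assms(1-4) unfolding minors_vanish_def by (metis mult.right_neutral)+
      then show ?thesis by (simp add: algebra_simps)
    qed
    then have "?z n $ (i, l) = ?z n $ (i, k) * x n $ (j, l) + y n $ (i, k) * ?z n $ (j, l)" for n
      unfolding sgn_div_norm vector_scaleR_component
      by (simp add: scaleR_add_right del: vector_minus_component)
    moreover have "(\<lambda>n. ?z n $ (i, k) * x n $ (j, l) + y n $ (i, k) * ?z n $ (j, l))
      \<longlonglongrightarrow> Z $ (i, k) * X $ (j, l) + X $ (i, k) * Z $ (j, l)"
      using assms(5,6) by (intro tendsto_intros z)
    ultimately show "(\<lambda>n. ?z n $ (i, l)) \<longlonglongrightarrow> Z $ (i, k) * X $ (j, l) + X $ (i, k) * Z $ (j, l)"
      by simp
  qed
  have "Z $ p = (tensor2 (\<chi> i. Z $ (i, k)) (\<chi> l. X $ (j, l)) + tensor2 (\<chi> i. X $ (i, k)) (\<chi> l. Z $ (j, l))) $ p"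
    for p using Z[of "fst p" "snd p"] by (simp add: tensor2_def case_prod_unfold)
  then show "Z = tensor2 (\<chi> i. Z $ (i, k)) (\<chi> l. X $ (j, l)) + tensor2 (\<chi> i. X $ (i, k)) (\<chi> l. Z $ (j, l))"
    unfolding vec_eq_iff by blast
  show "Z $ (j, k) = 0"
    using LIMSEQ_unique[OF z[of "(j, k)"], of 0] assms(3,4) by (simp add: sgn_div_norm)
qed

text \<open>A limit of normalized rank one matrices from the images of the \<open>S n\<close> again
  has rank one and lies in the image of T. Its projective point is therefore in the intersection,
  which consists of \<open>p\<close> alone.\<close>

lemma rank_one_limit_unique:
  assumes seg: "projectivization (range (contract T)) \<inter> segre = {p}"
    and "inj (contract T)" "S \<longlonglongrightarrow> T"
    and x: "\<And>n. x n \<in> range (contract (S n))" "\<And>n. x n \<noteq> 0" "\<And>n. minors_vanish (x n)"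
  obtains r X where "strict_mono r" "(\<lambda>n. sgn (x (r n))) \<longlonglongrightarrow> X" "X \<in> range (contract T)" "X \<noteq> 0"
    "minors_vanish X" "proj_point X = p"
proof -
  obtain r X where r: "strict_mono r" "(\<lambda>n. sgn (x (r n))) \<longlonglongrightarrow> X" "X \<in> range (contract T)" "X \<noteq> 0"
    using sgn_limit_in_range_contract[OF assms(2,3) x(1,2)] by blast
  have X: "minors_vanish X"
    by (rule minors_vanish_limit[OF _ r(2)]) (simp add: sgn_div_norm minors_vanish_scaleR x(3))
  have "proj_point X \<in> projectivization (range (contract T)) \<inter> segre"
    using r X minors_vanish_imp_proj_point_in_segre by (auto simp: projectivization_def)
  then show thesis using that[OF r X] seg by simp
qed

text \<open>Division by the entry at \<open>q\<close> is unaffected by a nonzero rescaling, so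
  \<open>x n\<close> may be replaced by \<open>sgn (x n)\<close>. If \<open>x n\<close> is zero,
  both expressions are zero.\<close>

lemma normalized_limit:
  fixes x :: "nat \<Rightarrow> complex^'n::finite"
  assumes "(\<lambda>n. sgn (x n)) \<longlonglongrightarrow> X" "X $ q \<noteq> 0"
  shows "(\<lambda>n. inverse (x n $ q) *s x n) \<longlonglongrightarrow> inverse (X $ q) *s X"
proof (rule vec_tendstoI)
  fix p
  have "(\<lambda>n. inverse (sgn (x n) $ q) * sgn (x n) $ p) \<longlonglongrightarrow> inverse (X $ q) * X $ p"
    using assms by (intro tendsto_mult tendsto_inverse tendsto_vec_nth)
  moreover have "inverse (sgn (x n) $ q) * sgn (x n) $ p = inverse (x n $ q) * x n $ p" for n
    by (cases "x n = 0") (simp_all add: sgn_div_norm inverse_scaleR_distrib)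
  ultimately show "(\<lambda>n. (inverse (x n $ q) *s x n) $ p) \<longlonglongrightarrow> (inverse (X $ q) *s X) $ p"
    by simp
qed

section \<open>The limiting line in the tangent space\<close>

theorem proposition2p4:
  fixes T :: "complex^('a::finite \<times> 'b::finite \<times> 'c::finite)"
    and X\<^sub>0 :: "complex^('b \<times> 'c)"
    and m :: nat
  assumes "CARD('a) = m"
    and "m \<ge> 2"
    and "A_concise T"
    and "border_rank T = m"
    and "projectivization (tensor_map T ` dual_space) \<inter> segre = {proj_point X\<^sub>0}"
  shows "\<exists>l. projective_line l \<and>
           l \<subseteq> projectivization
                 (tensor_map T ` dual_space \<inter> affine_tangent_space segre (proj_point X\<^sub>0))"
proof -
  note inj = A_concise_imp_inj_contract[OF assms(3)]
  note seg = assms(5)[unfolded image_tensor_map]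
  obtain S\<^sub>0 where S\<^sub>0: "\<And>n. S\<^sub>0 n \<in> sums_of_rank_one CARD('a)" "S\<^sub>0 \<longlonglongrightarrow> T"
    using border_rank_approximation[of T] assms(1,4) by metis
  obtain c where c: "c > 0" "\<forall>\<^sub>F n in sequentially. \<forall>\<alpha>. c * norm \<alpha> \<le> norm (contract (S\<^sub>0 n) \<alpha>)"
    using contract_uniformly_bounded_below[OF inj S\<^sub>0(2)] by blast
  then obtain N where N: "\<And>n \<alpha>. n \<ge> N \<Longrightarrow> c * norm \<alpha> \<le> norm (contract (S\<^sub>0 n) \<alpha>)"
    by (auto simp: eventually_sequentially)
  \<comment> \<open>Dropping the first \<open>N\<close> terms makes every map in the sequence
    injective, so that two rank one matrices can be chosen for each n.\<close>
  define S where "S n = S\<^sub>0 (n + N)" for n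
  have S: "S n \<in> sums_of_rank_one CARD('a)" for n using S\<^sub>0 by (simp add: S_def)
  have ST: "S \<longlonglongrightarrow> T" unfolding S_def using S\<^sub>0(2) by (rule LIMSEQ_ignore_initial_segment)
  have S_inj: "inj (contract (S n))" for n
  proof (rule injI)
    fix \<alpha> \<beta> assume "contract (S n) \<alpha> = contract (S n) \<beta>"
    then have "contract (S n) (\<alpha> - \<beta>) = 0"
      by (simp add: bounded_bilinear.diff_right[OF bounded_bilinear_contract])
    then have "c * norm (\<alpha> - \<beta>) \<le> 0" using N[of "n + N" "\<alpha> - \<beta>"] by (simp add: S_def)
    then show "\<alpha> = \<beta>" using c(1) by (simp add: mult_le_0_iff)
  qed
  have "\<exists>x y. minors_vanish x \<and> minors_vanish y \<and> x \<noteq> y \<and> vec.independent {x, y} \<and>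
      x \<in> range (contract (S n)) \<and> y \<in> range (contract (S n))" for n
    using two_independent_rank_ones[OF S S_inj] assms(1,2) by metis
  then obtain x y where xy: "\<And>n. minors_vanish (x n)" "\<And>n. minors_vanish (y n)" "\<And>n. x n \<noteq> y n"
    "\<And>n. vec.independent {x n, y n}"
    "\<And>n. x n \<in> range (contract (S n))" "\<And>n. y n \<in> range (contract (S n))"
    by metis
  have nz: "x n \<noteq> 0" "y n \<noteq> 0" for n
    using xy(4)[of n] vec.dependent_zero[of "{x n, y n}"] by auto
  obtain r X where r: "strict_mono r" "(\<lambda>n. sgn (x (r n))) \<longlonglongrightarrow> X" "X \<in> range (contract T)" "X \<noteq> 0"
    "minors_vanish X" "proj_point X = proj_point X\<^sub>0"
    using rank_one_limit_unique[OF seg inj ST, of x] xy nz by metis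
  have STr: "(\<lambda>n. S (r n)) \<longlonglongrightarrow> T" using LIMSEQ_subseq_LIMSEQ[OF ST r(1)] by (simp add: o_def)
  \<comment> \<open>The second extraction is made inside the first subsequence, so that both
    normalized sequences converge along the composite \<open>t\<close>.\<close>
  obtain s Y where s: "strict_mono s" "(\<lambda>n. sgn (y (r (s n)))) \<longlonglongrightarrow> Y" "Y \<noteq> 0"
    "proj_point Y = proj_point X\<^sub>0"
    using rank_one_limit_unique[OF seg inj STr, of "\<lambda>n. y (r n)"] xy nz by metis
  define t where "t n = r (s n)" for n
  have STt: "(\<lambda>n. S (t n)) \<longlonglongrightarrow> T"
    using LIMSEQ_subseq_LIMSEQ[OF STr s(1)] by (simp add: o_def t_def)
  have xlim: "(\<lambda>n. sgn (x (t n))) \<longlonglongrightarrow> X"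
    using LIMSEQ_subseq_LIMSEQ[OF r(2) s(1)] by (simp add: o_def t_def)
  have ylim: "(\<lambda>n. sgn (y (t n))) \<longlonglongrightarrow> Y" using s(2) by (simp add: t_def)
  obtain a where a: "a \<noteq> 0" "Y = a *s X" using proj_point_eqD[of X Y] r s by metis
  \<comment> \<open>A nonzero entry of \<open>X\<close> selects an affine chart. The limits
    \<open>X\<close> and \<open>Y\<close> agree only up to the scalar \<open>a\<close>; scaling the
    entry at \<open>?q\<close> to 1 cancels \<open>a\<close> and gives both sequences the same limit
    \<open>X'\<close>.\<close>
  obtain j k where jk: "X $ (j, k) \<noteq> 0" using r(4) by (auto simp: vec_eq_iff)
  let ?q = "(j, k)"
  define X' where "X' = inverse (X $ ?q) *s X"
  define x' where "x' n = inverse (x (t n) $ ?q) *s x (t n)" for n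
  define y' where "y' n = inverse (y (t n) $ ?q) *s y (t n)" for n
  have x'lim: "x' \<longlonglongrightarrow> X'"
    unfolding x'_def X'_def using normalized_limit[OF xlim jk] .
  have "X' = inverse (Y $ ?q) *s Y" using a jk by (simp add: X'_def vec_eq_iff)
  then have y'lim: "y' \<longlonglongrightarrow> X'"
    unfolding y'_def using normalized_limit[OF ylim, of ?q] a jk by simp
  \<comment> \<open>Since the inverse of 0 is 0, the entry of \<open>x' n\<close> at
    \<open>?q\<close> is 1 or 0, and it is nonzero exactly when the original entry is. The same
    holds for \<open>y' n\<close>, and a further shift by \<open>M\<close> leaves only entries equal
    to 1.\<close>
  have "\<forall>\<^sub>F n in sequentially. x' n $ ?q \<noteq> 0 \<and> y' n $ ?q \<noteq> 0"
  proof (intro eventually_conj tendsto_imp_eventually_ne)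
    show "(\<lambda>n. x' n $ ?q) \<longlonglongrightarrow> X' $ ?q" "(\<lambda>n. y' n $ ?q) \<longlonglongrightarrow> X' $ ?q"
      using x'lim y'lim by (auto intro: tendsto_intros)
  qed (use jk in \<open>simp_all add: X'_def\<close>)
  then obtain M where M: "\<And>n. n \<ge> M \<Longrightarrow> x' n $ ?q \<noteq> 0 \<and> y' n $ ?q \<noteq> 0"
    by (auto simp: eventually_sequentially)
  define x'' where "x'' n = x' (n + M)" for n
  define y'' where "y'' n = y' (n + M)" for n
  have entry: "x (t (n + M)) $ ?q \<noteq> 0" "y (t (n + M)) $ ?q \<noteq> 0" for n
    using M[of "n + M"] by (auto simp: x'_def y'_def)
  have one: "x'' n $ ?q = 1" "y'' n $ ?q = 1" for n
    using entry[of n] by (simp_all add: x''_def y''_def x'_def y'_def)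
  have lim: "x'' \<longlonglongrightarrow> X'" "y'' \<longlonglongrightarrow> X'"
    unfolding x''_def y''_def using x'lim y'lim by (auto intro: LIMSEQ_ignore_initial_segment)
  have minors: "minors_vanish (x'' n)" "minors_vanish (y'' n)" for n
    by (simp_all add: x''_def y''_def x'_def y'_def minors_vanish_scale xy)
  have STM: "(\<lambda>n. S (t (n + M))) \<longlonglongrightarrow> T" using STt by (rule LIMSEQ_ignore_initial_segment)
  have mem: "x'' n - y'' n \<in> range (contract (S (t (n + M))))" for n
    unfolding x''_def y''_def x'_def y'_def
    by (intro vec.subspace_diff vec.subspace_scale vec_subspace_range_contract xy)
  \<comment> \<open>Equality would be a linear relation between the independent matrices
    \<open>x (t (n + M))\<close> and \<open>y (t (n + M))\<close> with nonzero coefficients.\<close>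
  have ne: "x'' n - y'' n \<noteq> 0" for n
  proof
    assume "x'' n - y'' n = 0"
    then have "inverse (x (t (n + M)) $ ?q) *s x (t (n + M)) = inverse (y (t (n + M)) $ ?q) *s y (t (n + M))"
      by (simp add: x''_def y''_def x'_def y'_def)
    from independent_pairD[OF xy(4,3) this] show False using entry(1)[of n] by simp
  qed
  obtain u Z where u: "strict_mono u" "(\<lambda>n. sgn (x'' (u n) - y'' (u n))) \<longlonglongrightarrow> Z"
    "Z \<in> range (contract T)" "Z \<noteq> 0"
    using sgn_limit_in_range_contract[OF inj STM mem ne] by blast
  have limu: "(\<lambda>n. x'' (u n)) \<longlonglongrightarrow> X'" "(\<lambda>n. y'' (u n)) \<longlonglongrightarrow> X'"
    using LIMSEQ_subseq_LIMSEQ[OF lim(1) u(1)] LIMSEQ_subseq_LIMSEQ[OF lim(2) u(1)]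
    by (simp_all add: o_def)
  note Z = secant_limit[OF minors one limu u(2)]
  let ?b = "\<chi> i. X' $ (i, k)" and ?c = "\<chi> l. X' $ (j, l)"
  have X'q: "X' $ ?q = 1" using jk by (simp add: X'_def)
  have X'_eq: "X' = tensor2 ?b ?c"
  proof -
    have "minors_vanish X'" using r(5) by (simp add: X'_def minors_vanish_scale)
    then have X'_nth: "X' $ (i, l) = X' $ (i, k) * X' $ (j, l)" for i l
      using X'q unfolding minors_vanish_def by (metis mult.right_neutral)
    have "X' $ p = tensor2 ?b ?c $ p" for p
      using X'_nth[of "fst p" "snd p"] by (simp add: tensor2_def case_prod_unfold)
    then show ?thesis unfolding vec_eq_iff by blast
  qed
  have X'_ne: "X' \<noteq> 0" using X'q by auto
  have "X \<in> vec.span {X}" by (simp add: vec.span_base)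
  then have X'_p: "X' \<in> proj_point X\<^sub>0"
    using r(6) by (simp add: proj_point_def X'_def vec.span_scale)
  let ?E = "range (contract T) \<inter> affine_tangent_space segre (proj_point X\<^sub>0)"
  have tangent: "tensor2 v ?c + tensor2 ?b w \<in> affine_tangent_space segre (proj_point X\<^sub>0)" for v w
    by (rule velocity_in_affine_tangent_space) (use X'_p X'_ne in \<open>simp_all add: X'_eq[symmetric]\<close>)
  have "X' \<in> range (contract T)"
    unfolding X'_def by (intro vec.subspace_scale vec_subspace_range_contract r)
  moreover have "X' \<in> affine_tangent_space segre (proj_point X\<^sub>0)"
  proof -
    have "tensor2 ?b (0 :: complex^'c) = 0" by (auto simp: tensor2_def vec_eq_iff)
    \<comment> \<open>The base point is itself tangent, being the velocity obtained by scaling its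
      first factor.\<close>
    then show ?thesis using tangent[of ?b 0] by (simp add: X'_eq[symmetric])
  qed
  moreover have "Z \<in> affine_tangent_space segre (proj_point X\<^sub>0)"
    by (subst Z(1)) (rule tangent)
  ultimately have "{X', Z} \<subseteq> ?E" using u(3) by simp
  moreover have "vec.subspace ?E"
    unfolding affine_tangent_space_def
    by (intro vec.subspace_inter vec_subspace_range_contract vec.subspace_span)
  ultimately have L: "vec.span {X', Z} \<subseteq> ?E" by (rule vec.span_minimal)
  \<comment> \<open>The entry at \<open>?q\<close> separates the two: it is 1 for \<open>X'\<close>
    and 0 for \<open>Z\<close>. Hence they span a plane, whose projectivization is the required
    line.\<close>
  have notin: "X' \<notin> vec.span {Z}"
  proof
    assume "X' \<in> vec.span {Z}"
    then obtain d where "X' = d *s Z" by (auto simp: vec.span_singleton)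
    then show False using X'q Z(2) by simp
  qed
  have ne': "X' \<noteq> Z" using X'q Z(2) by force
  have "vec.independent {X', Z}"
    using notin ne' u(4) by (simp add: vec.independent_insert)
  then have dim: "vec.dim (vec.span {X', Z}) = 2"
    using ne' by (simp add: vec.dim_eq_card_independent)
  have "projective_line (projectivization (vec.span {X', Z}))"
    unfolding projective_line_def
    by (intro exI[of _ "vec.span {X', Z}"] conjI refl vec.subspace_span dim)
  moreover have "projectivization (vec.span {X', Z}) \<subseteq> projectivization ?E"
    unfolding projectivization_def by (intro image_mono Diff_mono L subset_refl)
  ultimately show ?thesis
    unfolding image_tensor_map by (intro exI[of _ "projectivization (vec.span {X', Z})"] conjI)
qed

end
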